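(* Let $g$ solve system (S3) with initial data $h_{ii}>0$, $h_{11}\le h_{22}\le h_{33}$, and suppose $h\in D_{L_0}$, i.e. the solution of the planar system (P) starting at $(h_{00}^{1/3}h_{22},h_{00}^{1/3}h_{33})$ converges to $P_0$ (the point where $a=b=c$). Then the solution of (S3) exists for all $t\ge 0$, $g_{00}$ does not converge to $0$ (it converges to a positive limit), and $g_{11},g_{22},g_{33}$ all converge to the same positive value.
   Context: Let $\det h = h_{00}h_{11}h_{22}h_{33}$, $\beta=\frac{1}{6(\det h)^2}$, $p(x,y,z) = x^4 - x^3(y+z) + x^2yz + x(-y^3+y^2z+yz^2-z^3) + y^4 - y^3z - yz^3 + z^4$, $q(x,y,z) = 5x^4 - 3x^3(y+z) + x^2yz + x(y^3-y^2z-yz^2+z^3) - 3y^4 + 3y^3z + 3yz^3 - 3z^4$, $r(x,y,z) = \tfrac12(p+3q)(x,y,z) = 8x^4-5x^3(y+z)+2x^2yz+x(y^3-y^2z-yz^2+z^3)-4y^4+4y^3z+4yz^3-4z^4$. System (S3): $\dot g_{00} = -\beta\,p(g_{11},g_{22},g_{33})\,g_{00}^3$, $\dot g_{11} = -\beta\,q(g_{11},g_{22},g_{33})\,g_{00}^2g_{11}$, $\dot g_{22} = -\beta\,q(g_{22},g_{33},g_{11})\,g_{00}^2g_{22}$, $\dot g_{33} = -\beta\,q(g_{33},g_{11},g_{22})\,g_{00}^2g_{33}$, $g_{ii}(0)=h_{ii}$ (Bach flow on $\mathbb{R}\times\mathbb{S}^3$ in a diagonalizing frame; $g_{00}g_{11}g_{22}g_{33}=\det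 h$ is preserved). Set $a=g_{00}^{1/3}g_{11}$, $b=g_{00}^{1/3}g_{22}$, $c=g_{00}^{1/3}g_{33}$, so $abc=\det h$. Under (S3), $(b,c)$ follows, up to a time reparametrization, the planar system (P): $\dot b=-\tfrac23 r(b,a,c)\,b$, $\dot c=-\tfrac23 r(c,a,b)\,c$ with $a=\det h/(bc)$, on the region $a\le b\le c$. $P_0$ is the point $b=c=(\det h)^{1/3}$; $D_{L_0}$ is the set of initial metrics whose (P)-trajectory converges to $P_0$. *)

theory Defs
  imports "HOL-Analysis.Analysis"
begin

definition bach_p :: "real \<Rightarrow> real \<Rightarrow> real \<Rightarrow> real" where
  "bach_p x y z = x^4 - x^3*(y+z) + x^2*y*z + x*(-(y^3) + y^2*z + y*z^2 - z^3)
                  + y^4 - y^3*z - y*z^3 + z^4"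

definition bach_q :: "real \<Rightarrow> real \<Rightarrow> real \<Rightarrow> real" where
  "bach_q x y z = 5*x^4 - 3*x^3*(y+z) + x^2*y*z + x*(y^3 - y^2*z - y*z^2 + z^3)
                  - 3*y^4 + 3*y^3*z + 3*y*z^3 - 3*z^4"

definition bach_r :: "real \<Rightarrow> real \<Rightarrow> real \<Rightarrow> real" where
  "bach_r x y z = (bach_p x y z + 3 * bach_q x y z) / 2"

definition S3_solution ::
  "real \<Rightarrow> real \<Rightarrow> real \<Rightarrow> real \<Rightarrow>
   (real \<Rightarrow> real) \<Rightarrow> (real \<Rightarrow> real) \<Rightarrow> (real \<Rightarrow> real) \<Rightarrow> (real \<Rightarrow> real) \<Rightarrow> bool" where
  "S3_solution h0 h1 h2 h3 g0 g1 g2 g3 \<longleftrightarrow>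
     (let \<beta> = 1 / (6 * (h0*h1*h2*h3)^2) in
      g0 0 = h0 \<and> g1 0 = h1 \<and> g2 0 = h2 \<and> g3 0 = h3 \<and>
      (\<forall>t\<ge>0.
        (g0 has_real_derivative (- \<beta> * bach_p (g1 t) (g2 t) (g3 t) * (g0 t)^3)) (at t within {0..}) \<and>
        (g1 has_real_derivative (- \<beta> * bach_q (g1 t) (g2 t) (g3 t) * (g0 t)^2 * g1 t)) (at t within {0..}) \<and>
        (g2 has_real_derivative (- \<beta> * bach_q (g2 t) (g3 t) (g1 t) * (g0 t)^2 * g2 t)) (at t within {0..}) \<and>
        (g3 has_real_derivative (- \<beta> * bach_q (g3 t) (g1 t) (g2 t) * (g0 t)^2 * g3 t)) (at t within {0..})))"

text \<open>(b,c) solves the planar system (P) on [0,\<infinity>) with parameter D = det h and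
  initial data (b0,c0), where a = D/(b c); b, c stay positive.\<close>
definition P_solution ::
  "real \<Rightarrow> real \<Rightarrow> real \<Rightarrow> (real \<Rightarrow> real) \<Rightarrow> (real \<Rightarrow> real) \<Rightarrow> bool" where
  "P_solution D b0 c0 b c \<longleftrightarrow>
     b 0 = b0 \<and> c 0 = c0 \<and>
     (\<forall>t\<ge>0. b t > 0 \<and> c t > 0 \<and>
       (b has_real_derivative (- (2/3) * bach_r (b t) (D / (b t * c t)) (c t) * b t)) (at t within {0..}) \<and>
       (c has_real_derivative (- (2/3) * bach_r (c t) (D / (b t * c t)) (b t) * c t)) (at t within {0..}))"

definition in_DL0 :: "real \<Rightarrow> real \<Rightarrow> real \<Rightarrow> real \<Rightarrow> bool" where
  "in_DL0 h0 h1 h2 h3 \<longleftrightarrow>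
     (let D = h0*h1*h2*h3 in
      \<exists>b c. P_solution D (root 3 h0 * h2) (root 3 h0 * h3) b c \<and>
            (b \<longlongrightarrow> root 3 D) at_top \<and> (c \<longlongrightarrow> root 3 D) at_top)"

end

theory Submission
  imports Defs
begin

text \<open>Let \<open>\<gamma> = g\<^sub>0\<^sub>0^(1/3)\<close>. In the time \<open>\<tau>\<close> of the planar system, \<open>\<gamma>' = - \<gamma> p(a, b, c) / 3\<close>,
  so a planar trajectory yields a solution of (S3) by one quadrature for \<open>\<gamma>\<close> and one for the time
  change \<open>dt/d\<tau> = 1 / (\<beta> \<gamma>^2)\<close>. As \<open>p\<close> is a sum of squares, \<open>\<gamma>\<close> is nonincreasing, hence \<open>t \<rightarrow> \<infinity>\<close> as
  \<open>\<tau> \<rightarrow> \<infinity>\<close> and the solution is global. Near \<open>P\<^sub>0\<close> the differences \<open>b - a\<close>, \<open>c - a\<close> decay exponentially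
  and \<open>p\<close> is quadratic in them, so \<open>\<integral> p d\<tau>\<close> is finite and \<open>\<gamma>\<close> has a positive limit; then
  \<open>g\<^sub>i\<^sub>i = a/\<gamma>, b/\<gamma>, c/\<gamma>\<close> share a limit. Any other solution coincides with this one because the
  vector field of (S3) is polynomial, hence Lipschitz on bounded sets.\<close>

section \<open>Calculus on the real line: comparison, antiderivatives, time changes\<close>

lemma has_real_derivative_nonneg_imp_le:
  fixes f :: "real \<Rightarrow> real"
  assumes "a \<le> b"
    and deriv: "\<And>t. t \<in> {a..b} \<Longrightarrow> (f has_real_derivative f' t) (at t within {a..b})"
    and nonneg: "\<And>t. t \<in> {a..b} \<Longrightarrow> 0 \<le> f' t"
  shows "f a \<le> f b"
proof (rule DERIV_nonneg_imp_increasing_open[OF \<open>a \<le> b\<close>])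
  fix t assume t: "a < t" "t < b"
  then have "(f has_real_derivative f' t) (at t)"
    using deriv[of t] by (simp add: at_within_Icc_at)
  then show "\<exists>y. (f has_real_derivative y) (at t) \<and> 0 \<le> y"
    using nonneg[of t] t by auto
next
  show "continuous_on {a..b} f"
    using deriv by (meson DERIV_continuous_on)
qed

text \<open>The integrating factor makes \<open>exp (- K * t) * u t\<close> nonincreasing, and it
  starts at 0. In the uniqueness proof \<open>u\<close> is the squared distance of two
  solutions.\<close>

lemma gronwall_zero:
  fixes u :: "real \<Rightarrow> real"
  assumes "0 \<le> T" and "u 0 = 0"
    and deriv: "\<And>t. t \<in> {0..T} \<Longrightarrow> (u has_real_derivative u' t) (at t within {0..T})"
    and bound: "\<And>t. t \<in> {0..T} \<Longrightarrow> u' t \<le> K * u t"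
  shows "u T \<le> 0"
proof -
  have "- (exp (- K * 0) * u 0) \<le> - (exp (- K * T) * u T)"
  proof (rule has_real_derivative_nonneg_imp_le[OF \<open>0 \<le> T\<close>])
    fix t assume t: "t \<in> {0..T}"
    show "((\<lambda>t. - (exp (- K * t) * u t)) has_real_derivative exp (- K * t) * (K * u t - u' t)) (at t within {0..T})"
      by (rule derivative_eq_intros deriv[OF t] refl | simp add: algebra_simps)+
    show "0 \<le> exp (- K * t) * (K * u t - u' t)"
      using bound[OF t] by simp
  qed
  then have "exp (- K * T) * u T \<le> 0"
    using \<open>u 0 = 0\<close> by simp
  then show ?thesis
    by (simp add: mult_le_0_iff)
qed

lemma ex_antiderivative_real:
  fixes f :: "real \<Rightarrow> real"
  assumes "continuous_on UNIV f"
  shows "\<exists>F. F 0 = 0 \<and> (\<forall>t. (F has_real_derivative f t) (at t))"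
proof -
  obtain F where F: "\<And>t. (F has_vector_derivative f t) (at t)"
    using einterval_antiderivative[of "-\<infinity>" "\<infinity>" f] assms
    by (auto simp: continuous_on_eq_continuous_at)
  have "((\<lambda>t. F t - F 0) has_real_derivative f t) (at t)" for t
    using F[of t] unfolding has_real_derivative_iff_has_vector_derivative
    by (auto intro!: derivative_eq_intros)
  then show ?thesis
    by (intro exI[of _ "\<lambda>t. F t - F 0"]) simp
qed

text \<open>Inverts the time change. The bound \<open>k\<close> makes \<open>T\<close> stretch
  distances by at least \<open>k\<close>, so \<open>T\<close> is injective and unbounded in both
  directions, and its inverse is (1/k)-Lipschitz. The resulting continuity is what the derivative
  rule for inverse functions asks for.\<close>

lemma inverse_function_of_deriv_ge:
  fixes T T' :: "real \<Rightarrow> real"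
  assumes "T 0 = 0" and "0 < k"
    and deriv: "\<And>t. (T has_real_derivative T' t) (at t)"
    and ge: "\<And>t. k \<le> T' t"
  obtains \<sigma> where "\<sigma> 0 = 0" and "\<And>t. (\<sigma> has_real_derivative inverse (T' (\<sigma> t))) (at t)"
    and "\<And>t. 0 \<le> t \<Longrightarrow> 0 \<le> \<sigma> t" and "filterlim \<sigma> at_top at_top"
proof -
  have expand: "k * (y - x) \<le> T y - T x" if "x \<le> y" for x y
  proof -
    have "T x - k * x \<le> T y - k * y"
    proof (rule has_real_derivative_nonneg_imp_le[OF that])
      fix t
      show "((\<lambda>t. T t - k * t) has_real_derivative T' t - k) (at t within {x..y})"
        by (rule derivative_eq_intros has_field_derivative_at_within[OF deriv] refl | simp)+
      show "0 \<le> T' t - k"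
        using ge[of t] by simp
    qed
    then show ?thesis by (simp add: algebra_simps)
  qed
  have cont: "continuous_on S T" for S
    using deriv by (meson DERIV_continuous_on has_field_derivative_at_within)
  have "\<exists>x. T x = y" for y
  proof -
    \<comment> \<open>Stretching from \<open>T 0 = 0\<close> gives
      \<open>T (- z) \<le> - \<bar>y\<bar>\<close> and \<open>\<bar>y\<bar> \<le> T z\<close>, a
      bracket for the intermediate value theorem.\<close>
    define z where "z = \<bar>y\<bar> / k"
    have "0 \<le> z" and kz: "k * z = \<bar>y\<bar>"
      using \<open>0 < k\<close> by (auto simp: z_def)
    then have "T (- z) \<le> y" "y \<le> T z"
      using expand[of 0 z] expand[of "- z" 0] \<open>T 0 = 0\<close> by auto
    then show ?thesis
      using IVT'[of T "- z" y z] \<open>0 \<le> z\<close> cont by auto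
  qed
  then obtain \<sigma> where \<sigma>: "\<And>y. T (\<sigma> y) = y" by metis
  have le: "x \<le> y" if "T x \<le> T y" for x y
  proof (rule ccontr)
    assume "\<not> x \<le> y"
    then have "0 < k * (x - y)" and "k * (x - y) \<le> T x - T y"
      using expand[of y x] \<open>0 < k\<close> by auto
    then show False using that by linarith
  qed
  have mono: "\<sigma> x \<le> \<sigma> y" if "x \<le> y" for x y
    using le \<sigma> that by simp
  have lip: "(1 / k)-lipschitz_on UNIV \<sigma>"
  proof (rule lipschitz_onI)
    fix x y
    have *: "\<bar>\<sigma> x - \<sigma> y\<bar> \<le> (y - x) / k" if "x \<le> y" for x y
      using expand[OF mono[OF that]] mono[OF that] \<sigma> \<open>0 < k\<close> by (simp add: field_simps)
    show "dist (\<sigma> x) (\<sigma> y) \<le> 1 / k * dist x y"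
      using *[of x y] *[of y x] by (cases "x \<le> y") (auto simp: dist_real_def abs_minus_commute)
  qed (use \<open>0 < k\<close> in simp)
  have "continuous_on UNIV \<sigma>"
    using lip by (rule lipschitz_on_continuous_on)
  then have cont_\<sigma>: "isCont \<sigma> t" for t
    by (simp add: continuous_on_eq_continuous_at)
  have "\<sigma> 0 = 0"
    using le[of "\<sigma> 0" 0] le[of 0 "\<sigma> 0"] \<sigma>[of 0] \<open>T 0 = 0\<close> by simp
  show thesis
  proof
    show "\<sigma> 0 = 0" by fact
    show "0 \<le> \<sigma> t" if "0 \<le> t" for t
      using mono[OF that] \<open>\<sigma> 0 = 0\<close> by simp
    show "(\<sigma> has_real_derivative inverse (T' (\<sigma> t))) (at t)" for t
      using ge[of "\<sigma> t"] \<open>0 < k\<close>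
      by (intro DERIV_inverse_function[OF deriv, of _ _ "t - 1" "t + 1"]) (auto simp: \<sigma> cont_\<sigma>)
    show "filterlim \<sigma> at_top at_top"
      unfolding filterlim_at_top eventually_at_top_linorder
    proof
      fix Z
      show "\<exists>N. \<forall>n\<ge>N. Z \<le> \<sigma> n"
        using le \<sigma> by (metis)
    qed
  qed
qed

lemma tendsto_at_top_mono_bounded:
  fixes f :: "real \<Rightarrow> real"
  assumes mono: "\<And>x y. a \<le> x \<Longrightarrow> x \<le> y \<Longrightarrow> f x \<le> f y"
    and bound: "\<And>x. a \<le> x \<Longrightarrow> f x \<le> B"
  shows "\<exists>l. (f \<longlongrightarrow> l) at_top"
proof -
  have bdd: "bdd_above (f ` {a..})"
    using bound by (auto intro!: bdd_aboveI)
  have "(f \<longlongrightarrow> Sup (f ` {a..})) at_top"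
  proof (rule increasing_tendsto)
    show "\<forall>\<^sub>F x in at_top. f x \<le> Sup (f ` {a..})"
      using eventually_ge_at_top[of a] by eventually_elim (auto intro!: cSup_upper bdd)
    fix z assume "z < Sup (f ` {a..})"
    then obtain x where x: "a \<le> x" "z < f x"
      using less_cSup_iff[OF _ bdd] by auto
    show "\<forall>\<^sub>F x in at_top. z < f x"
      using eventually_ge_at_top[of x] by eventually_elim (use x mono in force)
  qed
  then show ?thesis by blast
qed

section \<open>Algebra of the polynomials p, q and r\<close>

text \<open>Serves twice: it shows the sign of p, and it exhibits p as quadratic in the differences
  of its arguments.\<close>

lemma bach_p_sum_of_squares:
  "bach_p x y z = (((y - z) * (y + z - x))^2 + ((z - x) * (z + x - y))^2 + ((x - y) * (x + y - z))^2) / 2"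
  unfolding bach_p_def by (simp add: field_simps power2_eq_square power3_eq_cube power4_eq_xxxx)

lemma bach_p_nonneg: "0 \<le> bach_p x y z"
  unfolding bach_p_sum_of_squares by simp

lemma bach_p_cyclic:
  "bach_p z x y = bach_p x y z" "bach_p y z x = bach_p x y z"
  unfolding bach_p_def by algebra+

lemma bach_r_symmetric: "bach_r x z y = bach_r x y z"
  unfolding bach_r_def bach_p_def bach_q_def by algebra

text \<open>Infinitesimal form of the conservation of \<open>a * b * c\<close>: up to the factor -
  2/3, the summands are the logarithmic derivatives of a, b and c.\<close>

lemma bach_r_sum_zero: "bach_r x y z + bach_r y x z + bach_r z x y = 0"
  unfolding bach_r_def bach_p_def bach_q_def by (simp add: field_simps power2_eq_square power3_eq_cube power4_eq_xxxx)

lemma bach_p_scale: "s \<noteq> 0 \<Longrightarrow> bach_p (x / s) (y / s) (z / s) = bach_p x y z / s^4"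
  unfolding bach_p_def by (simp add: field_simps power2_eq_square power3_eq_cube power4_eq_xxxx)

lemma bach_q_scale: "s \<noteq> 0 \<Longrightarrow> bach_q (x / s) (y / s) (z / s) = bach_q x y z / s^4"
  unfolding bach_q_def by (simp add: field_simps power2_eq_square power3_eq_cube power4_eq_xxxx)

text \<open>The cofactor of \<open>x - y\<close> in
  \<open>bach_r x y z * x - bach_r y x z * y\<close>. Along (P) it governs the decay of a difference
  of two coordinates; its value 9 m^4 on the diagonal, times 2/3, is the limiting rate.\<close>

definition bach_s :: "real \<Rightarrow> real \<Rightarrow> real \<Rightarrow> real" where
  "bach_s x y z = 8 * (x^4 + x^3*y + x^2*y^2 + x*y^3 + y^4) - x*y*(x^2 + x*y + y^2)
     - 5*z*(x + y)*(x^2 + y^2) - 2*x*y*z*(x + y) - x^2*y^2 - x*y*z^2 + z^3*(x + y) - 4*z^4"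

lemma bach_r_difference: "bach_r x y z * x - bach_r y x z * y = (x - y) * bach_s x y z"
  unfolding bach_r_def bach_p_def bach_q_def bach_s_def
  by (simp add: field_simps power2_eq_square power3_eq_cube power4_eq_xxxx)

lemma bach_s_diagonal: "bach_s m m m = 9 * m^4"
  unfolding bach_s_def by (simp add: field_simps power2_eq_square power3_eq_cube power4_eq_xxxx)

text \<open>In each square of the sum-of-squares form the second factor is at most 3 M in absolute
  value. The term \<open>(b - c)^2\<close> costs at most twice the sum of the other two squares, so
  the constant is 3 * 9/2.\<close>

lemma bach_p_le:
  assumes "\<bar>a\<bar> \<le> M" "\<bar>b\<bar> \<le> M" "\<bar>c\<bar> \<le> M"
  shows "bach_p a b c \<le> 27 / 2 * M^2 * ((b - a)^2 + (c - a)^2)"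
proof -
  have sq: "((u - v) * (u + v - w))^2 \<le> 9 * M^2 * (u - v)^2"
    if "\<bar>u\<bar> \<le> M" "\<bar>v\<bar> \<le> M" "\<bar>w\<bar> \<le> M" for u v w
  proof -
    have "\<bar>u + v - w\<bar> \<le> \<bar>3 * M\<bar>" using that by linarith
    then have "(u + v - w)^2 \<le> (3 * M)^2" by (simp only: abs_le_square_iff)
    then have "(u - v)^2 * (u + v - w)^2 \<le> (u - v)^2 * (3 * M)^2"
      by (rule mult_left_mono) simp
    then show ?thesis by (simp add: power_mult_distrib mult_ac)
  qed
  have "(b - c)^2 \<le> 2 * ((b - a)^2 + (c - a)^2)"
    using zero_le_power2[of "(b - a) + (c - a)"] by (simp add: power2_eq_square algebra_simps)
  then have "M^2 * (b - c)^2 \<le> M^2 * (2 * ((b - a)^2 + (c - a)^2))"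
    by (rule mult_left_mono) simp
  then show ?thesis
    using sq[of b c a] sq[of c a b] sq[of a b c] assms
    unfolding bach_p_sum_of_squares
    by (simp add: power2_commute[of a b] distrib_left)
qed

section \<open>Uniqueness for (S3)\<close>

text \<open>Packages local Lipschitz continuity: \<open>N\<close> will be the distance of two
  solutions. Keeping the bound \<open>M\<close> next to the estimate makes the relation stable under
  products, so it passes to any polynomial expression without computing a Lipschitz
  constant.\<close>

definition bounded_close :: "real set \<Rightarrow> (real \<Rightarrow> real) \<Rightarrow> (real \<Rightarrow> real) \<Rightarrow> (real \<Rightarrow> real) \<Rightarrow> bool" where
  "bounded_close S N u v \<longleftrightarrow>
     (\<exists>M\<ge>0. \<exists>K\<ge>0. \<forall>t\<in>S. \<bar>u t\<bar> \<le> M \<and> \<bar>v t\<bar> \<le> M \<and> \<bar>u t - v t\<bar> \<le> K * N t)"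

lemma bounded_close_const: "(\<And>t. t \<in> S \<Longrightarrow> 0 \<le> N t) \<Longrightarrow> bounded_close S N (\<lambda>t. k) (\<lambda>t. k)"
  unfolding bounded_close_def by (intro exI[of _ "\<bar>k\<bar>"] conjI exI[of _ 0]) auto

lemma bounded_close_add:
  assumes "bounded_close S N u v" "bounded_close S N u' v'"
  shows "bounded_close S N (\<lambda>t. u t + u' t) (\<lambda>t. v t + v' t)"
proof -
  obtain M K where 1: "M \<ge> 0" "K \<ge> 0" "\<forall>t\<in>S. \<bar>u t\<bar> \<le> M \<and> \<bar>v t\<bar> \<le> M \<and> \<bar>u t - v t\<bar> \<le> K * N t"
    using assms(1) unfolding bounded_close_def by blast
  obtain M' K' where 2: "M' \<ge> 0" "K' \<ge> 0" "\<forall>t\<in>S. \<bar>u' t\<bar> \<le> M' \<and> \<bar>v' t\<bar> \<le> M' \<and> \<bar>u' t - v' t\<bar> \<le> K' * N t"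
    using assms(2) unfolding bounded_close_def by blast
  show ?thesis
    unfolding bounded_close_def
    using 1 2 by (intro exI[of _ "M + M'"] conjI exI[of _ "K + K'"]) (fastforce simp: distrib_right)+
qed

lemma bounded_close_mult:
  assumes "bounded_close S N u v" "bounded_close S N u' v'"
  shows "bounded_close S N (\<lambda>t. u t * u' t) (\<lambda>t. v t * v' t)"
proof -
  obtain M K where 1: "M \<ge> 0" "K \<ge> 0" "\<forall>t\<in>S. \<bar>u t\<bar> \<le> M \<and> \<bar>v t\<bar> \<le> M \<and> \<bar>u t - v t\<bar> \<le> K * N t"
    using assms(1) unfolding bounded_close_def by blast
  obtain M' K' where 2: "M' \<ge> 0" "K' \<ge> 0" "\<forall>t\<in>S. \<bar>u' t\<bar> \<le> M' \<and> \<bar>v' t\<bar> \<le> M' \<and> \<bar>u' t - v' t\<bar> \<le> K' * N t"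
    using assms(2) unfolding bounded_close_def by blast
  have "\<bar>u t * u' t - v t * v' t\<bar> \<le> (M * K' + M' * K) * N t" if "t \<in> S" for t
  proof -
    have "\<bar>u t * u' t - v t * v' t\<bar> = \<bar>u t * (u' t - v' t) + v' t * (u t - v t)\<bar>"
      by (simp add: algebra_simps)
    also have "\<dots> \<le> \<bar>u t\<bar> * \<bar>u' t - v' t\<bar> + \<bar>v' t\<bar> * \<bar>u t - v t\<bar>"
      by (metis abs_mult abs_triangle_ineq)
    also have "\<dots> \<le> M * (K' * N t) + M' * (K * N t)"
      using 1 2 that by (intro add_mono mult_mono) auto
    finally show ?thesis by (simp add: algebra_simps)
  qed
  then show ?thesis
    unfolding bounded_close_def
    using 1 2 by (intro exI[of _ "M * M'"] conjI exI[of _ "M * K' + M' * K"])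
      (auto simp: abs_mult intro!: mult_mono)
qed

lemma bounded_close_minus:
  "bounded_close S N u v \<Longrightarrow> bounded_close S N (\<lambda>t. - u t) (\<lambda>t. - v t)"
  unfolding bounded_close_def by (simp add: abs_minus_commute)

lemma bounded_close_diff:
  "bounded_close S N u v \<Longrightarrow> bounded_close S N u' v' \<Longrightarrow> bounded_close S N (\<lambda>t. u t - u' t) (\<lambda>t. v t - v' t)"
  using bounded_close_add[of S N u v "\<lambda>t. - u' t" "\<lambda>t. - v' t"] bounded_close_minus[of S N u' v'] by simp

lemma bounded_close_power:
  assumes "bounded_close S N u v" "\<And>t. t \<in> S \<Longrightarrow> 0 \<le> N t"
  shows "bounded_close S N (\<lambda>t. u t ^ n) (\<lambda>t. v t ^ n)"
  by (induction n) (auto intro!: bounded_close_const bounded_close_mult assms)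

text \<open>Energy estimate: on a compact interval both solutions are bounded, so the right-hand
  sides differ by O(\<open>N\<close>). The squared distance \<open>E\<close> then has derivative at
  most a constant times \<open>E\<close>, and Gronwall applies.\<close>

lemma S3_solution_unique:
  assumes g: "S3_solution h0 h1 h2 h3 g0 g1 g2 g3" and k: "S3_solution h0 h1 h2 h3 k0 k1 k2 k3"
    and "0 \<le> T"
  shows "g0 T = k0 T \<and> g1 T = k1 T \<and> g2 T = k2 T \<and> g3 T = k3 T"
proof -
  define \<beta> where "\<beta> = 1 / (6 * (h0*h1*h2*h3)^2)"
  define P where "P x0 x1 x2 x3 t = - \<beta> * bach_p (x1 t) (x2 t) (x3 t) * (x0 t)^3"
    for x0 x1 x2 x3 :: "real \<Rightarrow> real" and t
  \<comment> \<open>The equations for g11, g22, g33 are cyclic shifts of each other, so one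
    \<open>Q\<close> with permuted arguments covers all three.\<close>
  define Q where "Q x0 x1 x2 x3 t = - \<beta> * bach_q (x1 t) (x2 t) (x3 t) * (x0 t)^2 * x1 t"
    for x0 x1 x2 x3 :: "real \<Rightarrow> real" and t
  have sol: "(x0 has_real_derivative P x0 x1 x2 x3 t) (at t within {0..T})"
       "(x1 has_real_derivative Q x0 x1 x2 x3 t) (at t within {0..T})"
       "(x2 has_real_derivative Q x0 x2 x3 x1 t) (at t within {0..T})"
       "(x3 has_real_derivative Q x0 x3 x1 x2 t) (at t within {0..T})"
    if "S3_solution h0 h1 h2 h3 x0 x1 x2 x3" "t \<in> {0..T}" for x0 x1 x2 x3 t
    using that unfolding S3_solution_def Let_def \<beta>_def P_def Q_def
    by (auto intro: has_field_derivative_subset)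
  define E where "E t = (g0 t - k0 t)^2 + (g1 t - k1 t)^2 + (g2 t - k2 t)^2 + (g3 t - k3 t)^2" for t
  define N where "N t = sqrt (E t)" for t
  have E_nonneg: "0 \<le> E t" for t unfolding E_def by simp
  then have N_nonneg: "0 \<le> N t" and N_sq: "N t * N t = E t" for t unfolding N_def by auto
  have N_ge: "\<bar>g0 t - k0 t\<bar> \<le> N t" "\<bar>g1 t - k1 t\<bar> \<le> N t" "\<bar>g2 t - k2 t\<bar> \<le> N t" "\<bar>g3 t - k3 t\<bar> \<le> N t" for t
    unfolding N_def E_def by (auto intro!: real_le_rsqrt)
  have base: "bounded_close {0..T} N x y"
    if "\<And>t. \<bar>x t - y t\<bar> \<le> N t"
      and "\<And>t. t \<in> {0..T} \<Longrightarrow> (x has_real_derivative x' t) (at t within {0..T})"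
      and "\<And>t. t \<in> {0..T} \<Longrightarrow> (y has_real_derivative y' t) (at t within {0..T})" for x y x' y'
  proof -
    have "continuous_on {0..T} x" "continuous_on {0..T} y"
      using that(2,3) by (meson DERIV_continuous_on)+
    then have "bounded (x ` {0..T})" "bounded (y ` {0..T})"
      by (auto intro!: compact_imp_bounded compact_continuous_image)
    then obtain X Y where "\<forall>t\<in>{0..T}. \<bar>x t\<bar> \<le> X" "\<forall>t\<in>{0..T}. \<bar>y t\<bar> \<le> Y"
      unfolding bounded_iff by auto
    then show ?thesis
      unfolding bounded_close_def using that(1)
      by (intro exI[of _ "max 0 (max X Y)"] conjI exI[of _ 1]) (auto simp: le_max_iff_disj)
  qed
  have close: "bounded_close {0..T} N g0 k0" "bounded_close {0..T} N g1 k1"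
    "bounded_close {0..T} N g2 k2" "bounded_close {0..T} N g3 k3"
    using base[OF N_ge(1) sol(1)[OF g] sol(1)[OF k]] base[OF N_ge(2) sol(2)[OF g] sol(2)[OF k]]
      base[OF N_ge(3) sol(3)[OF g] sol(3)[OF k]] base[OF N_ge(4) sol(4)[OF g] sol(4)[OF k]] by auto
  note close_intros = bounded_close_const bounded_close_add bounded_close_mult bounded_close_minus
    bounded_close_diff bounded_close_power
  \<comment> \<open>Both right-hand sides are polynomials in the components, so the closure rules
    suffice.\<close>
  have P_close: "bounded_close {0..T} N (P x0 x1 x2 x3) (P y0 y1 y2 y3)"
   and Q_close: "bounded_close {0..T} N (Q x0 x1 x2 x3) (Q y0 y1 y2 y3)"
    if "bounded_close {0..T} N x0 y0" "bounded_close {0..T} N x1 y1"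
       "bounded_close {0..T} N x2 y2" "bounded_close {0..T} N x3 y3" for x0 x1 x2 x3 y0 y1 y2 y3
    unfolding P_def Q_def bach_p_def bach_q_def by (intro close_intros that N_nonneg)+
  have lipschitz: "\<exists>K. \<forall>t\<in>{0..T}. \<bar>u t - v t\<bar> \<le> K * N t" if "bounded_close {0..T} N u v" for u v
    using that unfolding bounded_close_def by blast
  obtain K0 where K0: "\<forall>t\<in>{0..T}. \<bar>P g0 g1 g2 g3 t - P k0 k1 k2 k3 t\<bar> \<le> K0 * N t"
    using lipschitz[OF P_close[OF close]] by blast
  obtain K1 where K1: "\<forall>t\<in>{0..T}. \<bar>Q g0 g1 g2 g3 t - Q k0 k1 k2 k3 t\<bar> \<le> K1 * N t"
    using lipschitz[OF Q_close[OF close]] by blast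
  obtain K2 where K2: "\<forall>t\<in>{0..T}. \<bar>Q g0 g2 g3 g1 t - Q k0 k2 k3 k1 t\<bar> \<le> K2 * N t"
    using lipschitz[OF Q_close[OF close(1,3,4,2)]] by blast
  obtain K3 where K3: "\<forall>t\<in>{0..T}. \<bar>Q g0 g3 g1 g2 t - Q k0 k3 k1 k2 t\<bar> \<le> K3 * N t"
    using lipschitz[OF Q_close[OF close(1,4,2,3)]] by blast
  define E' where "E' t = 2 * ((g0 t - k0 t) * (P g0 g1 g2 g3 t - P k0 k1 k2 k3 t)
     + (g1 t - k1 t) * (Q g0 g1 g2 g3 t - Q k0 k1 k2 k3 t)
     + (g2 t - k2 t) * (Q g0 g2 g3 g1 t - Q k0 k2 k3 k1 t)
     + (g3 t - k3 t) * (Q g0 g3 g1 g2 t - Q k0 k3 k1 k2 t))" for t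
  have "E T \<le> 0"
  proof (rule gronwall_zero[OF \<open>0 \<le> T\<close>])
    show "E 0 = 0"
      using g k unfolding E_def S3_solution_def Let_def by simp
    fix t assume t: "t \<in> {0..T}"
    show "(E has_real_derivative E' t) (at t within {0..T})"
      unfolding E_def[abs_def] E'_def
      by (rule derivative_eq_intros sol[OF g t] sol[OF k t] refl | simp add: algebra_simps)+
    have summand: "d * e \<le> K * E t" if "\<bar>d\<bar> \<le> N t" "\<bar>e\<bar> \<le> K * N t" for d e K
    proof -
      have "d * e \<le> \<bar>d\<bar> * \<bar>e\<bar>" by (metis abs_ge_self abs_mult)
      also have "\<dots> \<le> N t * (K * N t)"
        using that N_nonneg by (intro mult_mono) auto
      finally show ?thesis using N_sq[of t] by (simp add: mult_ac)
    qed
    show "E' t \<le> (2 * (K0 + K1 + K2 + K3)) * E t"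
      using summand[OF N_ge(1) K0[rule_format, OF t]] summand[OF N_ge(2) K1[rule_format, OF t]]
        summand[OF N_ge(3) K2[rule_format, OF t]] summand[OF N_ge(4) K3[rule_format, OF t]]
      unfolding E'_def by (simp add: distrib_left distrib_right)
  qed
  then have "N T = 0"
    using E_nonneg[of T] unfolding N_def by simp
  then show ?thesis
    using N_ge[of T] by simp
qed

section \<open>Convergence of the integral of p along the planar flow\<close>

text \<open>The differences \<open>b - a\<close> and \<open>c - a\<close> satisfy linear equations whose rates tend to \<open>6 m^4\<close>,
  so \<open>(b - a)^2 + (c - a)^2\<close> decays at a fixed rate and, suitably scaled, absorbs the growth of \<open>I\<close>.\<close>
lemma bach_p_integral_converges:
  fixes a b c I :: "real \<Rightarrow> real"
  assumes "0 < m"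
    and deriv_a: "\<And>t. 0 \<le> t \<Longrightarrow> (a has_real_derivative - (2/3) * bach_r (a t) (b t) (c t) * a t) (at t within {0..})"
    and deriv_b: "\<And>t. 0 \<le> t \<Longrightarrow> (b has_real_derivative - (2/3) * bach_r (b t) (a t) (c t) * b t) (at t within {0..})"
    and deriv_c: "\<And>t. 0 \<le> t \<Longrightarrow> (c has_real_derivative - (2/3) * bach_r (c t) (a t) (b t) * c t) (at t within {0..})"
    and deriv_I: "\<And>t. 0 \<le> t \<Longrightarrow> (I has_real_derivative bach_p (a t) (b t) (c t)) (at t within {0..})"
    and lim: "(a \<longlongrightarrow> m) at_top" "(b \<longlongrightarrow> m) at_top" "(c \<longlongrightarrow> m) at_top"
  shows "\<exists>l. (I \<longlongrightarrow> l) at_top"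
proof -
  define W where "W t = (b t - a t)^2 + (c t - a t)^2" for t
  define W' where "W' t = - (4/3) * ((b t - a t)^2 * bach_s (b t) (a t) (c t) + (c t - a t)^2 * bach_s (c t) (a t) (b t))" for t
  have deriv_W: "(W has_real_derivative W' t) (at t within {0..})" if "0 \<le> t" for t
  proof -
    \<comment> \<open>The factors \<open>b t - a t\<close> and \<open>c t - a t\<close> come from
      \<open>bach_r_difference\<close>; symmetry of r in its last two arguments lets the single
      equation for \<open>a\<close> serve both differences.\<close>
    have "W' t = 2 * (b t - a t) * (- (2/3) * ((b t - a t) * bach_s (b t) (a t) (c t)))
      + 2 * (c t - a t) * (- (2/3) * ((c t - a t) * bach_s (c t) (a t) (b t)))"
      unfolding W'_def by (simp add: power2_eq_square field_simps)
    also have "\<dots> = 2 * (b t - a t) * (- (2/3) * (bach_r (b t) (a t) (c t) * b t - bach_r (a t) (b t) (c t) * a t))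
      + 2 * (c t - a t) * (- (2/3) * (bach_r (c t) (a t) (b t) * c t - bach_r (a t) (b t) (c t) * a t))"
      using bach_r_difference[of "b t" "a t" "c t"] bach_r_difference[of "c t" "a t" "b t"]
        bach_r_symmetric[of "a t" "b t" "c t"] by simp
    finally have eq: "W' t = \<dots>" .
    show ?thesis
      unfolding W_def[abs_def] eq
      by (rule derivative_eq_intros deriv_a deriv_b deriv_c that refl | simp add: algebra_simps)+
  qed
  have "((\<lambda>t. bach_s (b t) (a t) (c t)) \<longlongrightarrow> bach_s m m m) at_top"
    "((\<lambda>t. bach_s (c t) (a t) (b t)) \<longlongrightarrow> bach_s m m m) at_top"
    unfolding bach_s_def by (intro tendsto_intros lim)+
  \<comment> \<open>A threshold strictly between 0 and the limit 9 m^4, so that both cofactors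
    eventually exceed it.\<close>
  moreover have "m^4 < bach_s m m m"
    using \<open>0 < m\<close> by (simp add: bach_s_diagonal)
  ultimately have ev_s: "\<forall>\<^sub>F t in at_top. m^4 < bach_s (b t) (a t) (c t)" "\<forall>\<^sub>F t in at_top. m^4 < bach_s (c t) (a t) (b t)"
    by (auto intro: order_tendstoD(1))
  have ev_bd: "\<forall>\<^sub>F t in at_top. \<bar>x t\<bar> \<le> 2 * m" if "(x \<longlongrightarrow> m) at_top" for x :: "real \<Rightarrow> real"
    using order_tendstoD[OF that, of 0] order_tendstoD[OF that, of "2 * m"] \<open>0 < m\<close>
    by (auto elim: eventually_elim2)
  obtain t0 where t0: "\<And>t. t0 \<le> t \<Longrightarrow> 0 \<le> t \<and> m^4 < bach_s (b t) (a t) (c t) \<and> m^4 < bach_s (c t) (a t) (b t)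
      \<and> \<bar>a t\<bar> \<le> 2 * m \<and> \<bar>b t\<bar> \<le> 2 * m \<and> \<bar>c t\<bar> \<le> 2 * m"
    using eventually_conj[OF eventually_ge_at_top[of 0] eventually_conj[OF ev_s(1) eventually_conj[OF ev_s(2)
      eventually_conj[OF ev_bd[OF lim(1)] eventually_conj[OF ev_bd[OF lim(2)] ev_bd[OF lim(3)]]]]]]
    unfolding eventually_at_top_linorder by blast
  \<comment> \<open>Chosen so that \<open>K * m^4 = 54 * m^2\<close>, which is the constant of
    \<open>bach_p_le\<close> for \<open>M = 2 * m\<close>. The guaranteed decay of
    \<open>K * W\<close> then outweighs the growth of \<open>I\<close>.\<close>
  define K where "K = 54 / m^2"
  have decay: "bach_p (a t) (b t) (c t) + K * W' t \<le> 0" if "t0 \<le> t" for t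
  proof -
    have "W t * m^4 \<le> (b t - a t)^2 * bach_s (b t) (a t) (c t) + (c t - a t)^2 * bach_s (c t) (a t) (b t)"
      unfolding W_def distrib_right
      using t0[OF that] by (intro add_mono mult_left_mono) auto
    moreover have "0 \<le> W t * m^4" unfolding W_def by simp
    ultimately have "W' t \<le> - (W t * m^4)"
      unfolding W'_def by simp
    then have "K * W' t \<le> K * - (W t * m^4)"
      by (rule mult_left_mono) (simp add: K_def)
    also have "\<dots> = - (54 * m^2 * W t)"
      using \<open>0 < m\<close> by (simp add: K_def power2_eq_square power4_eq_xxxx)
    finally show ?thesis
      using bach_p_le[of "a t" "2 * m" "b t" "c t"] t0[OF that]
      by (simp add: W_def power_mult_distrib)
  qed
  \<comment> \<open>Past \<open>t0\<close> the sum \<open>I + K * W\<close> is nonincreasing, and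
    \<open>K * W\<close> is nonnegative.\<close>
  have bound: "I t \<le> I t0 + K * W t0" if "t0 \<le> t" for t
  proof -
    have "- (I t0 + K * W t0) \<le> - (I t + K * W t)"
    proof (rule has_real_derivative_nonneg_imp_le[OF that])
      fix s assume "s \<in> {t0..t}"
      then have s: "0 \<le> s" "t0 \<le> s" using t0[of s] by auto
      show "((\<lambda>t. - (I t + K * W t)) has_real_derivative - (bach_p (a s) (b s) (c s) + K * W' s)) (at s within {t0..t})"
        by (rule has_field_derivative_subset[where s = "{0..}"])
          (use t0[of t0] s in \<open>auto intro!: derivative_eq_intros deriv_I deriv_W\<close>)
      show "0 \<le> - (bach_p (a s) (b s) (c s) + K * W' s)"
        using decay[OF s(2)] by simp
    qed
    moreover have "0 \<le> K * W t" by (simp add: K_def W_def)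
    ultimately show ?thesis by simp
  qed
  have mono: "I x \<le> I y" if "t0 \<le> x" "x \<le> y" for x y
  proof (rule has_real_derivative_nonneg_imp_le[OF that(2)])
    fix s assume "s \<in> {x..y}"
    then show "(I has_real_derivative bach_p (a s) (b s) (c s)) (at s within {x..y})"
      using t0[of s] t0[of x] that
      by (intro has_field_derivative_subset[OF deriv_I]) auto
  qed (rule bach_p_nonneg)
  show ?thesis
    by (rule tendsto_at_top_mono_bounded[of t0 I, OF mono bound])
qed

section \<open>From a planar trajectory to a solution of (S3)\<close>

text \<open>Since the three values of r add up to zero, the dependent variable a = D/(bc) obeys an
  equation of the same form as b and c.\<close>

lemma P_solution_first_deriv:
  fixes D :: real
  assumes P: "P_solution D b0 c0 b c" and "0 \<le> t"
  defines "a \<equiv> \<lambda>t. D / (b t * c t)"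
  shows "(a has_real_derivative - (2/3) * bach_r (a t) (b t) (c t) * a t) (at t within {0..})"
proof -
  have pos: "b t > 0" "c t > 0"
    and b: "(b has_real_derivative (- (2/3) * bach_r (b t) (a t) (c t) * b t)) (at t within {0..})"
    and c: "(c has_real_derivative (- (2/3) * bach_r (c t) (a t) (b t) * c t)) (at t within {0..})"
    using P \<open>0 \<le> t\<close> unfolding P_solution_def a_def by auto
  have r: "bach_r (a t) (b t) (c t) = - bach_r (b t) (a t) (c t) - bach_r (c t) (a t) (b t)"
    using bach_r_sum_zero[of "a t" "b t" "c t"] by simp
  show ?thesis
    unfolding r
    by (subst a_def, (rule derivative_eq_intros b c refl)+)
      (use pos in \<open>auto simp: a_def field_simps\<close>)
qed

text \<open>At time 0 only a one-sided derivative of \<open>f\<close> is available;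
  \<open>\<sigma>\<close> must map nonnegative times to nonnegative times for the chain rule to
  apply there.\<close>

lemma has_real_derivative_chain_atLeast:
  fixes f \<sigma> :: "real \<Rightarrow> real"
  assumes "(f has_real_derivative f') (at (\<sigma> t) within {0..})"
    and "(\<sigma> has_real_derivative s) (at t)" and "\<And>t. 0 \<le> t \<Longrightarrow> 0 \<le> \<sigma> t"
  shows "((\<lambda>t. f (\<sigma> t)) has_real_derivative f' * s) (at t within {0..})"
proof -
  have "(f has_real_derivative f') (at (\<sigma> t) within (\<sigma> ` {0..}))"
    by (rule has_field_derivative_subset[OF assms(1)]) (use assms(3) in auto)
  from DERIV_image_chain[OF this has_field_derivative_at_within[OF assms(2)]]
  show ?thesis by (simp add: o_def)
qed

lemma S3_solution_from_P_solution:
  fixes h0 h1 h2 h3 :: real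
  assumes pos: "h0 > 0" "h1 > 0" "h2 > 0" "h3 > 0"
    and P: "P_solution (h0*h1*h2*h3) (root 3 h0 * h2) (root 3 h0 * h3) b c"
    and lim_b: "(b \<longlongrightarrow> root 3 (h0*h1*h2*h3)) at_top"
    and lim_c: "(c \<longlongrightarrow> root 3 (h0*h1*h2*h3)) at_top"
  obtains g0 g1 g2 g3 L M where "S3_solution h0 h1 h2 h3 g0 g1 g2 g3"
    and "0 < L" "(g0 \<longlongrightarrow> L) at_top"
    and "0 < M" "(g1 \<longlongrightarrow> M) at_top" "(g2 \<longlongrightarrow> M) at_top" "(g3 \<longlongrightarrow> M) at_top"
proof -
  define D where "D = h0*h1*h2*h3"
  define m where "m = root 3 D"
  define \<rho> where "\<rho> = root 3 h0"
  define \<beta> where "\<beta> = 1 / (6 * D^2)"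
  define a where "a t = D / (b t * c t)" for t
  have "0 < D" "0 < m" "0 < \<rho>" "0 < \<beta>" and m3: "m^3 = D" and \<rho>3: "\<rho>^3 = h0"
    using pos by (auto simp: D_def m_def \<rho>_def \<beta>_def odd_real_root_pow)
  have bc_pos: "0 < b t" "0 < c t"
    and deriv_b: "(b has_real_derivative - (2/3) * bach_r (b t) (a t) (c t) * b t) (at t within {0..})"
    and deriv_c: "(c has_real_derivative - (2/3) * bach_r (c t) (a t) (b t) * c t) (at t within {0..})"
    if "0 \<le> t" for t
    using P that unfolding P_solution_def a_def D_def by auto
  \<comment> \<open>The first value is \<open>D / (\<rho>^2 * h2 * h3) = h0 * h1 / \<rho>^2\<close>,
    which simplifies by \<open>\<rho>^3 = h0\<close>.\<close>
  have init: "a 0 = \<rho> * h1" "b 0 = \<rho> * h2" "c 0 = \<rho> * h3"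
    using P pos \<open>0 < \<rho>\<close> \<rho>3 unfolding P_solution_def a_def
    by (auto simp: \<rho>_def[symmetric] D_def field_simps power3_eq_cube)
  have deriv_a: "(a has_real_derivative - (2/3) * bach_r (a t) (b t) (c t) * a t) (at t within {0..})"
    if "0 \<le> t" for t
    using P_solution_first_deriv[OF P that] unfolding a_def[abs_def] D_def .
  have lim: "(a \<longlongrightarrow> m) at_top" "(b \<longlongrightarrow> m) at_top" "(c \<longlongrightarrow> m) at_top"
  proof -
    show b: "(b \<longlongrightarrow> m) at_top" and c: "(c \<longlongrightarrow> m) at_top"
      using lim_b lim_c by (auto simp: m_def D_def)
    have "(a \<longlongrightarrow> D / (m * m)) at_top"
      unfolding a_def[abs_def] using \<open>0 < m\<close> by (intro tendsto_intros b c) auto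
    then show "(a \<longlongrightarrow> m) at_top"
      using \<open>0 < m\<close> by (simp flip: m3 add: power3_eq_cube)
  qed
  \<comment> \<open>Freezing a function at its value at 0 for negative times extends it continuously
    to the whole line, where the antiderivative and inversion lemmas live.\<close>
  have cont_max: "continuous_on UNIV (\<lambda>t. f (max 0 t))" if "continuous_on {0..} f" for f :: "real \<Rightarrow> real"
    by (rule continuous_on_compose2[OF that]) (auto intro!: continuous_intros)
  have "continuous_on {0..} a" "continuous_on {0..} b" "continuous_on {0..} c"
    by (rule DERIV_continuous_on, (rule deriv_a deriv_b deriv_c), simp)+
  then have "continuous_on {0..} (\<lambda>t. bach_p (a t) (b t) (c t))"
    unfolding bach_p_def by (intro continuous_intros)
  from ex_antiderivative_real[OF cont_max[OF this]]
  obtain I where I0: "I 0 = 0"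
    and I: "\<And>t. (I has_real_derivative bach_p (a (max 0 t)) (b (max 0 t)) (c (max 0 t))) (at t)"
    by blast
  have deriv_I: "(I has_real_derivative bach_p (a t) (b t) (c t)) (at t within {0..})" if "0 \<le> t" for t
    using has_field_derivative_at_within[OF I[of t]] that by (simp add: max_absorb2)
  obtain l where l: "(I \<longlongrightarrow> l) at_top"
    using bach_p_integral_converges[OF \<open>0 < m\<close> deriv_a deriv_b deriv_c deriv_I lim] by blast
  \<comment> \<open>Solves \<gamma>' = - p \<gamma> / 3 with initial value \<open>\<rho>\<close>,
    the cube root of \<open>h0\<close>; convergence of \<open>I\<close> gives a positive
    limit.\<close>
  define \<gamma> where "\<gamma> t = \<rho> * exp (- I t / 3)" for t
  have \<gamma>_pos: "0 < \<gamma> t" for t unfolding \<gamma>_def using \<open>0 < \<rho>\<close> by simp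
  have deriv_\<gamma>: "(\<gamma> has_real_derivative - (bach_p (a t) (b t) (c t) / 3) * \<gamma> t) (at t within {0..})"
    if "0 \<le> t" for t
    unfolding \<gamma>_def[abs_def]
    by (rule derivative_eq_intros deriv_I[OF that] refl | simp)+
  have \<gamma>_le: "\<gamma> t \<le> \<rho>" if "0 \<le> t" for t
  proof -
    have "I 0 \<le> I t"
      by (rule has_real_derivative_nonneg_imp_le[OF that])
        (auto intro!: has_field_derivative_at_within[OF I] bach_p_nonneg)
    then show ?thesis
      using I0 \<open>0 < \<rho>\<close> by (simp add: \<gamma>_def)
  qed
  have "continuous_on {0..} (\<lambda>t. 1 / (\<beta> * \<gamma> t ^ 2))"
    using DERIV_continuous_on[OF deriv_\<gamma>] \<gamma>_pos \<open>0 < \<beta>\<close>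
    by (auto intro!: continuous_intros simp: less_imp_neq[symmetric])
  from ex_antiderivative_real[OF cont_max[OF this]]
  obtain T where T0: "T 0 = 0"
    and T: "\<And>t. (T has_real_derivative 1 / (\<beta> * \<gamma> (max 0 t) ^ 2)) (at t)"
    by blast
  \<comment> \<open>This lower bound on dt/d\<tau> makes t reach every nonnegative value, so the
    solution of (S3) is global.\<close>
  have T_ge: "1 / (\<beta> * \<rho> ^ 2) \<le> 1 / (\<beta> * \<gamma> (max 0 t) ^ 2)" for t
    using \<gamma>_le[of "max 0 t"] \<gamma>_pos[of "max 0 t"] \<open>0 < \<beta>\<close>
    by (intro divide_left_mono mult_left_mono power_mono) auto
  obtain \<sigma> where \<sigma>0: "\<sigma> 0 = 0"
    and deriv_\<sigma>: "\<And>t. (\<sigma> has_real_derivative inverse (1 / (\<beta> * \<gamma> (max 0 (\<sigma> t)) ^ 2))) (at t)"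
    and \<sigma>_nonneg: "\<And>t. 0 \<le> t \<Longrightarrow> 0 \<le> \<sigma> t" and \<sigma>_top: "filterlim \<sigma> at_top at_top"
    using inverse_function_of_deriv_ge[OF T0 _ T T_ge] \<open>0 < \<beta>\<close> \<open>0 < \<rho>\<close> by auto
  have chain: "((\<lambda>t. f (\<sigma> t)) has_real_derivative f' * (\<beta> * \<gamma> (\<sigma> t) ^ 2)) (at t within {0..})"
    if "0 \<le> t" "(f has_real_derivative f') (at (\<sigma> t) within {0..})" for f f' t
    using has_real_derivative_chain_atLeast[OF that(2) deriv_\<sigma> \<sigma>_nonneg] \<sigma>_nonneg[OF that(1)]
    by (simp add: max_absorb2)
  \<comment> \<open>As r = (p + 3q)/2, the rates of x and \<gamma> combine to - (2/3) r + p/3 = - q.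
    Homogeneity of degree 4 turns q of the quotients into q / \<gamma>^4, and with g00^2 =
    \<gamma>^6 this leaves exactly the factor \<beta> \<gamma>^2 of the time change. The hypothesis
    on p allows cyclic shifts of a, b, c.\<close>
  have quotient: "((\<lambda>t. x (\<sigma> t) / \<gamma> (\<sigma> t)) has_real_derivative
      - \<beta> * bach_q (x s / \<gamma> s) (y s / \<gamma> s) (z s / \<gamma> s) * ((\<gamma> s)^3)^2 * (x s / \<gamma> s)) (at t within {0..})"
    if "0 \<le> t" "s = \<sigma> t"
      and x: "\<And>t. 0 \<le> t \<Longrightarrow> (x has_real_derivative - (2/3) * bach_r (x t) (y t) (z t) * x t) (at t within {0..})"
      and p: "bach_p (x s) (y s) (z s) = bach_p (a s) (b s) (c s)" for x y z s t
  proof -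
    have "0 \<le> s" using \<sigma>_nonneg that by simp
    have "((\<lambda>s. x s / \<gamma> s) has_real_derivative - bach_q (x s) (y s) (z s) * x s / \<gamma> s) (at s within {0..})"
      by (rule derivative_eq_intros x[OF \<open>0 \<le> s\<close>] deriv_\<gamma>[OF \<open>0 \<le> s\<close>] refl)+
        (use \<gamma>_pos[of s] in \<open>auto simp: p[symmetric] bach_r_def field_simps\<close>)
    from chain[OF \<open>0 \<le> t\<close> this[unfolded \<open>s = \<sigma> t\<close>]]
    show ?thesis
      using \<gamma>_pos[of s]
      by (elim DERIV_cong) (simp add: \<open>s = \<sigma> t\<close> bach_q_scale field_simps power2_eq_square power3_eq_cube power4_eq_xxxx)
  qed
  have cube: "((\<lambda>t. \<gamma> (\<sigma> t) ^ 3) has_real_derivative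
      - \<beta> * bach_p (a s / \<gamma> s) (b s / \<gamma> s) (c s / \<gamma> s) * ((\<gamma> s)^3)^3) (at t within {0..})"
    if "0 \<le> t" "s = \<sigma> t" for s t
  proof -
    have "0 \<le> s" using \<sigma>_nonneg that by simp
    have "((\<lambda>s. \<gamma> s ^ 3) has_real_derivative - bach_p (a s) (b s) (c s) * \<gamma> s ^ 3) (at s within {0..})"
      by (rule derivative_eq_intros deriv_\<gamma>[OF \<open>0 \<le> s\<close>] refl)+
        (simp add: power2_eq_square power3_eq_cube)
    from chain[OF \<open>0 \<le> t\<close> this[unfolded \<open>s = \<sigma> t\<close>]]
    show ?thesis
      using \<gamma>_pos[of s]
      by (elim DERIV_cong) (simp add: \<open>s = \<sigma> t\<close> bach_p_scale field_simps power2_eq_square power3_eq_cube power4_eq_xxxx)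
  qed
  \<comment> \<open>Reorders the arguments to the cyclic order in which (S3) states the equation for
    g22.\<close>
  have deriv_b': "(b has_real_derivative - (2/3) * bach_r (b t) (c t) (a t) * b t) (at t within {0..})"
    if "0 \<le> t" for t
    using deriv_b[OF that] by (simp add: bach_r_symmetric[of "b t" "c t" "a t"])
  define g where "g x t = x (\<sigma> t) / \<gamma> (\<sigma> t)" for x :: "real \<Rightarrow> real" and t
  have "S3_solution h0 h1 h2 h3 (\<lambda>t. \<gamma> (\<sigma> t) ^ 3) (g a) (g b) (g c)"
    unfolding S3_solution_def Let_def D_def[symmetric] \<beta>_def[symmetric]
  proof (intro conjI allI impI)
    have "\<gamma> 0 = \<rho>" by (simp add: \<gamma>_def I0)
    then show "\<gamma> (\<sigma> 0) ^ 3 = h0" "g a 0 = h1" "g b 0 = h2" "g c 0 = h3"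
      using \<open>0 < \<rho>\<close> by (auto simp: \<sigma>0 g_def init \<rho>3)
    fix t :: real assume "0 \<le> t"
    show "((\<lambda>t. \<gamma> (\<sigma> t) ^ 3) has_real_derivative
       - \<beta> * bach_p (g a t) (g b t) (g c t) * (\<gamma> (\<sigma> t) ^ 3)^3) (at t within {0..})"
      unfolding g_def by (rule cube[OF \<open>0 \<le> t\<close> refl])
    show "(g a has_real_derivative
       - \<beta> * bach_q (g a t) (g b t) (g c t) * (\<gamma> (\<sigma> t) ^ 3)^2 * g a t) (at t within {0..})"
      unfolding g_def[abs_def] by (rule quotient[OF \<open>0 \<le> t\<close> refl deriv_a refl])
    show "(g b has_real_derivative
       - \<beta> * bach_q (g b t) (g c t) (g a t) * (\<gamma> (\<sigma> t) ^ 3)^2 * g b t) (at t within {0..})"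
      unfolding g_def[abs_def]
      by (rule quotient[OF \<open>0 \<le> t\<close> refl deriv_b']) (auto simp: bach_p_cyclic)
    show "(g c has_real_derivative
       - \<beta> * bach_q (g c t) (g a t) (g b t) * (\<gamma> (\<sigma> t) ^ 3)^2 * g c t) (at t within {0..})"
      unfolding g_def[abs_def]
      by (rule quotient[OF \<open>0 \<le> t\<close> refl deriv_c]) (auto simp: bach_p_cyclic)
  qed
  moreover
  define \<Gamma> where "\<Gamma> = \<rho> * exp (- l / 3)"
  have "0 < \<Gamma>" using \<open>0 < \<rho>\<close> by (simp add: \<Gamma>_def)
  have lim_\<gamma>: "((\<lambda>t. \<gamma> (\<sigma> t)) \<longlongrightarrow> \<Gamma>) at_top"
    by (rule filterlim_compose[OF _ \<sigma>_top]) (auto simp: \<gamma>_def[abs_def] \<Gamma>_def intro!: tendsto_intros l)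
  have "((\<lambda>t. \<gamma> (\<sigma> t) ^ 3) \<longlongrightarrow> \<Gamma> ^ 3) at_top"
    by (intro tendsto_intros lim_\<gamma>)
  moreover have lim_g: "(g x \<longlongrightarrow> m / \<Gamma>) at_top" if "(x \<longlongrightarrow> m) at_top" for x
    unfolding g_def[abs_def] using \<open>0 < \<Gamma>\<close>
    by (intro tendsto_divide lim_\<gamma> filterlim_compose[OF that \<sigma>_top]) auto
  ultimately show thesis
    using that[of _ "g a" "g b" "g c" "\<Gamma> ^ 3" "m / \<Gamma>"] \<open>0 < \<Gamma>\<close> \<open>0 < m\<close> lim lim_g by simp
qed

section \<open>Transfer of the limits to every solution\<close>

theorem theorem5p22:
  fixes h0 h1 h2 h3 :: real
  assumes "h0 > 0" "h1 > 0" "h2 > 0" "h3 > 0"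
    and "h1 \<le> h2" "h2 \<le> h3"
    and "in_DL0 h0 h1 h2 h3"
  shows "(\<exists>g0 g1 g2 g3. S3_solution h0 h1 h2 h3 g0 g1 g2 g3) \<and>
         (\<forall>g0 g1 g2 g3. S3_solution h0 h1 h2 h3 g0 g1 g2 g3 \<longrightarrow>
            (\<exists>L>0. (g0 \<longlongrightarrow> L) at_top) \<and>
            (\<exists>M>0. (g1 \<longlongrightarrow> M) at_top \<and> (g2 \<longlongrightarrow> M) at_top \<and> (g3 \<longlongrightarrow> M) at_top))"
proof -
  obtain b c where "P_solution (h0*h1*h2*h3) (root 3 h0 * h2) (root 3 h0 * h3) b c"
    "(b \<longlongrightarrow> root 3 (h0*h1*h2*h3)) at_top" "(c \<longlongrightarrow> root 3 (h0*h1*h2*h3)) at_top"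
    using assms(7) unfolding in_DL0_def Let_def by blast
  then obtain k0 k1 k2 k3 L M where k: "S3_solution h0 h1 h2 h3 k0 k1 k2 k3"
    and L: "0 < L" "(k0 \<longlongrightarrow> L) at_top"
    and M: "0 < M" "(k1 \<longlongrightarrow> M) at_top" "(k2 \<longlongrightarrow> M) at_top" "(k3 \<longlongrightarrow> M) at_top"
    using S3_solution_from_P_solution assms(1-4) by metis
  have "(g0 \<longlongrightarrow> L) at_top \<and> (g1 \<longlongrightarrow> M) at_top \<and> (g2 \<longlongrightarrow> M) at_top \<and> (g3 \<longlongrightarrow> M) at_top"
    if g: "S3_solution h0 h1 h2 h3 g0 g1 g2 g3" for g0 g1 g2 g3
  proof -
    \<comment> \<open>Uniqueness gives agreement only for nonnegative times, since (S3) leaves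
      negative times unconstrained; this is enough for limits at infinity.\<close>
    have transfer: "(f \<longlongrightarrow> l) at_top"
      if "(f' \<longlongrightarrow> l) at_top" "\<And>t. 0 \<le> t \<Longrightarrow> f' t = f t" for f f' :: "real \<Rightarrow> real" and l
      by (rule Lim_transform_eventually[OF that(1)])
        (use eventually_ge_at_top[of 0] in \<open>eventually_elim, use that(2) in simp\<close>)
    show ?thesis
      using S3_solution_unique[OF k g] by (intro conjI transfer[OF L(2)] transfer[OF M(2)]
        transfer[OF M(3)] transfer[OF M(4)]) auto
  qed
  then show ?thesis
    using k L(1) M(1) by blast
qed

end
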